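(* Let $\{(b_i,d_i)\}_{i=1}^N$ be a persistence diagram, $K\ge1$ an integer, $M\subset\mathbb{R}$ a finite set, and let $f:\mathbb{R}^{K\times|M|}\to\mathbb{R}$ be any function (model) such that $v_f(\varnothing)=0$. Then there is exactly one credit allocation for the game $v_f$ given by a rule satisfying the Efficiency, Symmetry, Linearity and Null player axioms, namely the Shapley value $\varphi(v_f)$. That is, $\varphi$ satisfies the four axioms, and every credit allocation rule $\psi$ on cooperative games with player set $\{1,\dots,N\}$ satisfying the four axioms has $\psi_i(v_f)=\varphi_i(v_f)$ for every $i\in\{1,\dots,N\}$.
   Context: A persistence diagram here is a finite indexed family of points $(b_i,d_i)\in\mathbb{R}^2$ with $b_i\le d_i$, $i=1,\dots,N$, $N\ge1$. The tent function of point $i$ is $\ell_i(m)=\min(\max(0,m-b_i),\max(0,d_i-m))$. For a coalition $S\subset\{1,\dots,N\}$, $\Lambda(S)\in\mathbb{R}^{K\times|M|}$ is the discretized persistence landscape of the points in $S$: for $k\in\{1,\dots,K\}$, $m\in M$, $\Lambda(S)_{(k,m)}$ is the $k$-th largest value (with multiplicity) among $\{\ell_i(m):i\in S\}$ if $|S|\ge k$, and $0$ if $|S|<k$. The game of $f$ is $v_f(S)=f(\Lambda(S))$. A cooperative game on $\{1,\dots,N\}$ is a function $v:2^{\{1,\dots,N\}}\to\mathbb{R}$ with $v(\varnothing)=0$. A credit allocation rule $\psi$ assigns to each such game $v$ a vector $(\psi_1(v),\dots,\psi_N(v))\in\mathbb{R}^N$. The axioms, for all games $v,w$ on $\{1,\dots,N\}$,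 are: Efficiency: $\sum_{i=1}^N\psi_i(v)=v(\{1,\dots,N\})$. Symmetry: if $v(S\cup\{i\})=v(S\cup\{j\})$ for all $S$ with $i,j\notin S$, then $\psi_i(v)=\psi_j(v)$. Linearity: $\psi_i(v+w)=\psi_i(v)+\psi_i(w)$ for all $i$, where $(v+w)(S)=v(S)+w(S)$. Null player: if $v(S\cup\{i\})=v(S)$ for all coalitions $S$, then $\psi_i(v)=0$. The Shapley value is $\varphi_i(v)=\frac1N\sum_{S\subset\{1,\dots,N\}\setminus\{i\}}\binom{N-1}{|S|}^{-1}(v(S\cup\{i\})-v(S))$. *)

theory Defs
  imports Complex_Main "HOL-Library.FuncSet" "HOL-Library.Multiset"
begin

definition players :: "nat \<Rightarrow> nat set" where
  "players N = {1..N}"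

text \<open>
  A set-theoretic function on a carrier is represented as an extensional HOL function on it
  (\<^const>\<open>extensional\<close>), so that two games agreeing on all coalitions are equal and a
  rule cannot inspect values on sets that are not coalitions.
\<close>

definition games :: "nat \<Rightarrow> (nat set \<Rightarrow> real) set" where
  "games N = {v \<in> Pow (players N) \<rightarrow>\<^sub>E UNIV. v {} = 0}"

definition game_add :: "nat \<Rightarrow> (nat set \<Rightarrow> real) \<Rightarrow> (nat set \<Rightarrow> real) \<Rightarrow> nat set \<Rightarrow> real" where
  "game_add N v w = (\<lambda>S\<in>Pow (players N). v S + w S)"

text \<open>
  In the vector \<open>\<psi> v\<close> assigned by a rule only the components \<open>\<psi> v i\<close> for
  players \<open>i\<close> are meaningful, and only for games \<open>v\<close>.
\<close>

type_synonym allocation_rule = "(nat set \<Rightarrow> real) \<Rightarrow> nat \<Rightarrow> real"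

definition efficiency :: "nat \<Rightarrow> allocation_rule \<Rightarrow> bool" where
  "efficiency N \<psi> \<longleftrightarrow> (\<forall>v\<in>games N. (\<Sum>i\<in>players N. \<psi> v i) = v (players N))"

definition symmetry :: "nat \<Rightarrow> allocation_rule \<Rightarrow> bool" where
  "symmetry N \<psi> \<longleftrightarrow>
     (\<forall>v\<in>games N. \<forall>i\<in>players N. \<forall>j\<in>players N.
        (\<forall>S. S \<subseteq> players N \<and> i \<notin> S \<and> j \<notin> S \<longrightarrow> v (S \<union> {i}) = v (S \<union> {j})) \<longrightarrow>
        \<psi> v i = \<psi> v j)"

definition linearity :: "nat \<Rightarrow> allocation_rule \<Rightarrow> bool" where
  "linearity N \<psi> \<longleftrightarrow>
     (\<forall>v\<in>games N. \<forall>w\<in>games N. \<forall>i\<in>players N. \<psi> (game_add N v w) i = \<psi> v i + \<psi> w i)"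

definition null_player :: "nat \<Rightarrow> allocation_rule \<Rightarrow> bool" where
  "null_player N \<psi> \<longleftrightarrow>
     (\<forall>v\<in>games N. \<forall>i\<in>players N.
        (\<forall>S. S \<subseteq> players N \<longrightarrow> v (S \<union> {i}) = v S) \<longrightarrow> \<psi> v i = 0)"

definition shapley_axioms :: "nat \<Rightarrow> allocation_rule \<Rightarrow> bool" where
  "shapley_axioms N \<psi> \<longleftrightarrow> efficiency N \<psi> \<and> symmetry N \<psi> \<and> linearity N \<psi> \<and> null_player N \<psi>"

definition shapley :: "nat \<Rightarrow> allocation_rule" where
  "shapley N v i =
     1 / real N * (\<Sum>S\<in>Pow (players N - {i}).
        inverse (real ((N - 1) choose card S)) * (v (S \<union> {i}) - v S))"

definition persistence_diagram :: "nat \<Rightarrow> (nat \<Rightarrow> real) \<Rightarrow> (nat \<Rightarrow> real) \<Rightarrow> bool" where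
  "persistence_diagram N b d \<longleftrightarrow> N \<ge> 1 \<and> (\<forall>i\<in>players N. b i \<le> d i)"

definition tent :: "(nat \<Rightarrow> real) \<Rightarrow> (nat \<Rightarrow> real) \<Rightarrow> nat \<Rightarrow> real \<Rightarrow> real" where
  "tent b d i m = min (max 0 (m - b i)) (max 0 (d i - m))"

text \<open>
  The list below is the decreasing enumeration, with multiplicity, of the tent values at \<open>m\<close>;
  list positions start at 0, hence the index \<open>k - 1\<close> for \<open>k \<ge> 1\<close>.
\<close>

definition landscape_value ::
  "(nat \<Rightarrow> real) \<Rightarrow> (nat \<Rightarrow> real) \<Rightarrow> nat set \<Rightarrow> nat \<Rightarrow> real \<Rightarrow> real" where
  "landscape_value b d S k m =
     (if k \<le> card S
      then rev (sorted_list_of_multiset (image_mset (\<lambda>i. tent b d i m) (mset_set S))) ! (k - 1)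
      else 0)"

text \<open>
  The space of real arrays indexed by \<open>{1..K}\<close> and \<open>M\<close> is
  \<open>({1..K} \<times> M) \<rightarrow>\<^sub>E UNIV\<close>. Every function on it is the restriction of
  a total HOL function, so a model is a function on the whole type \<open>nat \<times> real \<Rightarrow> real\<close>,
  of which only the values on this space matter.
\<close>

definition landscape ::
  "nat \<Rightarrow> real set \<Rightarrow> (nat \<Rightarrow> real) \<Rightarrow> (nat \<Rightarrow> real) \<Rightarrow> nat set \<Rightarrow> nat \<times> real \<Rightarrow> real" where
  "landscape K M b d S = (\<lambda>(k, m)\<in>{1..K} \<times> M. landscape_value b d S k m)"

definition model_game ::
  "nat \<Rightarrow> nat \<Rightarrow> real set \<Rightarrow> (nat \<Rightarrow> real) \<Rightarrow> (nat \<Rightarrow> real) \<Rightarrow>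
   ((nat \<times> real \<Rightarrow> real) \<Rightarrow> real) \<Rightarrow> nat set \<Rightarrow> real" where
  "model_game N K M b d f = (\<lambda>S\<in>Pow (players N). f (landscape K M b d S))"

end

theory Submission
  imports Defs "HOL-Combinatorics.Transposition"
begin

text \<open>
  Moebius inversion on the lattice of coalitions writes every game as a finite sum of scaled
  unanimity games, where a unanimity game pays exactly the supersets of one fixed nonempty
  coalition \<open>T\<close>. On such a game the null player axiom annihilates the players outside \<open>T\<close>,
  symmetry equalizes those inside, and efficiency fixes the common value, so a rule obeying the
  axioms is determined there; linearity (used only as additivity, since the scalar is part of
  the unanimity game) carries this over to all games.
\<close>

lemma finite_players [simp]: "finite (players N)"
  and card_players [simp]: "card (players N) = N"
  by (simp_all add: players_def)

subsection \<open>The Shapley value satisfies the axioms\<close>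

text \<open>Both sides equal N divided by (N choose t). In the efficiency sum they are the total
  weights with which the worth of a coalition of size t enters positively, through its t members,
  and negatively, through the N - t players outside it.\<close>

lemma shapley_weight_balance:
  assumes "0 < t" "t < N"
  shows "real t * inverse (real ((N - 1) choose (t - 1))) =
    real (N - t) * inverse (real ((N - 1) choose t))"
proof -
  \<comment> \<open>By the two absorption identities, both products equal (N - 1) * ((N - 2) choose
    (t - 1)).\<close>
  have "t * ((N - 1) choose t) = (N - t) * ((N - 1) choose (t - 1))"
    using binomial_absorb_comp[of "N - 1" "t - 1"] binomial_absorption[of "t - 1" "N - 1"] assms
    by simp
  then have "real t * real ((N - 1) choose t) = real (N - t) * real ((N - 1) choose (t - 1))"
    by (metis of_nat_mult)
  moreover have "(N - 1) choose t > 0" "(N - 1) choose (t - 1) > 0"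
    using assms by simp_all
  ultimately show ?thesis
    by (simp add: field_simps)
qed

text \<open>Exchanging the sums over players and coalitions collects the coefficient of each
  \<open>v T\<close>. The coefficients cancel for all proper nonempty \<open>T\<close>, so only the
  grand coalition remains.\<close>

lemma shapley_efficiency: "efficiency N (shapley N)"
  unfolding efficiency_def
proof
  fix v assume "v \<in> games N"
  then have v0: "v {} = 0" by (simp add: games_def)
  define w where "w t = inverse (real ((N - 1) choose t))" for t
  let ?P = "players N"
  show "(\<Sum>i\<in>?P. shapley N v i) = v ?P"
  proof (cases "N = 0")
    case True
    then show ?thesis using v0 by (simp add: players_def)
  next
    case False
    have "(\<Sum>i\<in>?P. \<Sum>S\<in>Pow (?P - {i}). w (card S) * v (S \<union> {i})) =
      (\<Sum>i\<in>?P. \<Sum>T\<in>{T \<in> Pow ?P. i \<in> T}. w (card T - 1) * v T)"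
    proof (rule sum.cong[OF refl])
      fix i assume i: "i \<in> ?P"
      show "(\<Sum>S\<in>Pow (?P - {i}). w (card S) * v (S \<union> {i})) =
        (\<Sum>T\<in>{T \<in> Pow ?P. i \<in> T}. w (card T - 1) * v T)"
      proof (rule sum.reindex_bij_witness[of _ "\<lambda>T. T - {i}" "\<lambda>S. S \<union> {i}"])
        fix S assume "S \<in> Pow (?P - {i})"
        then have "finite S" "i \<notin> S" by (auto intro: finite_subset)
        then show "w (card (S \<union> {i}) - 1) * v (S \<union> {i}) = w (card S) * v (S \<union> {i})"
          by simp
      qed (use i in auto)
    qed
    also have "\<dots> = (\<Sum>T\<in>Pow ?P. \<Sum>i\<in>{i \<in> ?P. i \<in> T}. w (card T - 1) * v T)"
      by (rule sum.swap_restrict) simp_all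
    also have "\<dots> = (\<Sum>T\<in>Pow ?P. real (card T) * w (card T - 1) * v T)"
      by (intro sum.cong[OF refl]) (simp add: Collect_conj_eq Int_absorb1)
    finally have plus: "(\<Sum>i\<in>?P. \<Sum>S\<in>Pow (?P - {i}). w (card S) * v (S \<union> {i})) =
      (\<Sum>T\<in>Pow ?P. real (card T) * w (card T - 1) * v T)" .
    have "(\<Sum>i\<in>?P. \<Sum>S\<in>Pow (?P - {i}). w (card S) * v S) =
      (\<Sum>i\<in>?P. \<Sum>T\<in>{T \<in> Pow ?P. i \<notin> T}. w (card T) * v T)"
      by (intro sum.cong refl) auto
    also have "\<dots> = (\<Sum>T\<in>Pow ?P. \<Sum>i\<in>{i \<in> ?P. i \<notin> T}. w (card T) * v T)"
      by (rule sum.swap_restrict) simp_all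
    also have "\<dots> = (\<Sum>T\<in>Pow ?P. real (N - card T) * w (card T) * v T)"
    proof (rule sum.cong[OF refl])
      fix T assume "T \<in> Pow ?P"
      then have "card {i \<in> ?P. i \<notin> T} = N - card T"
        by (simp add: set_diff_eq[symmetric] card_Diff_subset finite_subset)
      then show "(\<Sum>i\<in>{i \<in> ?P. i \<notin> T}. w (card T) * v T) = real (N - card T) * w (card T) * v T"
        by simp
    qed
    finally have minus: "(\<Sum>i\<in>?P. \<Sum>S\<in>Pow (?P - {i}). w (card S) * v S) =
      (\<Sum>T\<in>Pow ?P. real (N - card T) * w (card T) * v T)" .
    \<comment> \<open>At \<open>T = {}\<close> the negative part keeps a nonzero weight and vanishes
      only because \<open>v {} = 0\<close>. At the grand coalition there are no outside players, and
      the weight \<open>w (N - 1)\<close> is 1.\<close>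
    have term_eq: "real (card T) * w (card T - 1) * v T - real (N - card T) * w (card T) * v T =
        (if T = ?P then real N * v T else 0)" if T: "T \<in> Pow ?P" for T
    proof -
      have fin: "finite T" using T by (auto intro: finite_subset)
      consider "T = {}" | "T = ?P" | "T \<noteq> {}" "T \<subset> ?P" using T by blast
      then show ?thesis
      proof cases
        case 1
        then show ?thesis using v0 by simp
      next
        case 2
        then show ?thesis by (simp add: w_def)
      next
        case 3
        then have "card T < N" "0 < card T"
          using psubset_card_mono[of ?P T] fin by (simp_all add: card_gt_0_iff)
        then have "real (card T) * w (card T - 1) = real (N - card T) * w (card T)"
          unfolding w_def by (intro shapley_weight_balance)
        then show ?thesis using 3 by (simp add: psubset_eq)
      qed
    qed
    have "(\<Sum>i\<in>?P. shapley N v i) = 1 / real N *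
      ((\<Sum>i\<in>?P. \<Sum>S\<in>Pow (?P - {i}). w (card S) * v (S \<union> {i})) -
       (\<Sum>i\<in>?P. \<Sum>S\<in>Pow (?P - {i}). w (card S) * v S))"
      by (simp only: shapley_def w_def[symmetric] sum_distrib_left[symmetric]
          right_diff_distrib sum_subtractf)
    also have "\<dots> = 1 / real N * (\<Sum>T\<in>Pow ?P. if T = ?P then real N * v T else 0)"
      by (simp only: plus minus sum_subtractf[symmetric] sum.cong[OF refl term_eq])
    also have "\<dots> = v ?P"
      using False by (simp add: sum.delta)
    finally show ?thesis .
  qed
qed

text \<open>Swapping \<open>i\<close> and \<open>j\<close> is a size-preserving bijection from the
  coalitions without \<open>i\<close> to those without \<open>j\<close>, and it matches the weighted
  marginal contributions term by term.\<close>

lemma shapley_symmetry: "symmetry N (shapley N)"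
  unfolding symmetry_def
proof (intro ballI impI)
  fix v :: "nat set \<Rightarrow> real" and i j :: nat
  let ?P = "players N"
  let ?\<tau> = "\<lambda>S. transpose i j ` S"
  assume i: "i \<in> ?P" and j: "j \<in> ?P"
    and sym: "\<forall>S. S \<subseteq> ?P \<and> i \<notin> S \<and> j \<notin> S \<longrightarrow> v (S \<union> {i}) = v (S \<union> {j})"
  have "(\<Sum>S\<in>Pow (?P - {i}). inverse (real ((N - 1) choose card S)) * (v (S \<union> {i}) - v S)) =
    (\<Sum>S\<in>Pow (?P - {j}). inverse (real ((N - 1) choose card S)) * (v (S \<union> {j}) - v S))"
  proof (rule sum.reindex_bij_witness[of _ ?\<tau> ?\<tau>])
    fix S assume S: "S \<in> Pow (?P - {i})"
    \<comment> \<open>If \<open>j\<close> lies in \<open>S\<close>, both enlarged coalitions are the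
      same set and the hypothesis is needed for \<open>v (?\<tau> S) = v S\<close>. Otherwise the
      swap fixes \<open>S\<close> and the hypothesis is needed for the enlarged coalitions.\<close>
    have "v (?\<tau> S \<union> {j}) = v (S \<union> {i}) \<and> v (?\<tau> S) = v S"
    proof (cases "j \<in> S")
      case True
      define R where "R = S - {j}"
      have R: "S = R \<union> {j}" "i \<notin> R" "j \<notin> R" "R \<subseteq> ?P" using True S by (auto simp: R_def)
      then have "?\<tau> S = R \<union> {i}"
        by simp
      moreover have "v (R \<union> {i}) = v (R \<union> {j})" using sym R by blast
      ultimately show ?thesis using R(1) by (simp add: insert_commute)
    next
      case False
      then have "?\<tau> S = S" using S by (intro transpose_image_eq) auto
      moreover have "v (S \<union> {i}) = v (S \<union> {j})" using sym S False by blast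
      ultimately show ?thesis by simp
    qed
    then show "inverse (real ((N - 1) choose card (?\<tau> S))) * (v (?\<tau> S \<union> {j}) - v (?\<tau> S)) =
      inverse (real ((N - 1) choose card S)) * (v (S \<union> {i}) - v S)"
      by (simp add: card_image)
  next
    fix S assume "S \<in> Pow (?P - {i})"
    then show "?\<tau> S \<in> Pow (?P - {j})" using i j by (auto simp: transpose_def)
  next
    fix S assume "S \<in> Pow (?P - {j})"
    then show "?\<tau> S \<in> Pow (?P - {i})" using i j by (auto simp: transpose_def)
  qed (simp_all add: image_image)
  then show "shapley N v i = shapley N v j"
    by (simp add: shapley_def)
qed

lemma shapley_linearity: "linearity N (shapley N)"
  unfolding linearity_def
proof (intro ballI)
  fix v w i assume i: "i \<in> players N"
  let ?c = "\<lambda>S. inverse (real ((N - 1) choose card S))"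
  have "(\<Sum>S\<in>Pow (players N - {i}). ?c S * (game_add N v w (S \<union> {i}) - game_add N v w S)) =
    (\<Sum>S\<in>Pow (players N - {i}). ?c S * (v (S \<union> {i}) - v S) + ?c S * (w (S \<union> {i}) - w S))"
  proof (rule sum.cong[OF refl])
    fix S assume "S \<in> Pow (players N - {i})"
    then have "S \<subseteq> players N" "S \<union> {i} \<subseteq> players N" using i by auto
    then show "?c S * (game_add N v w (S \<union> {i}) - game_add N v w S) =
        ?c S * (v (S \<union> {i}) - v S) + ?c S * (w (S \<union> {i}) - w S)"
      by (simp add: game_add_def algebra_simps)
  qed
  then show "shapley N (game_add N v w) i = shapley N v i + shapley N w i"
    by (simp add: shapley_def sum.distrib distrib_left)
qed

lemma shapley_null_player: "null_player N (shapley N)"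
  unfolding null_player_def shapley_def by (auto intro!: sum.neutral)

lemma shapley_axioms_shapley: "shapley_axioms N (shapley N)"
  by (simp add: shapley_axioms_def shapley_efficiency shapley_symmetry shapley_linearity
      shapley_null_player)

subsection \<open>Uniqueness\<close>

text \<open>The values \<open>c T\<close> are Harsanyi dividends. Keeping the family
  \<open>F\<close> as a parameter permits induction on it, and a singleton \<open>F\<close> gives a
  scaled unanimity game.\<close>

definition dividend_game :: "nat \<Rightarrow> nat set set \<Rightarrow> (nat set \<Rightarrow> real) \<Rightarrow> nat set \<Rightarrow> real" where
  "dividend_game N F c = (\<lambda>S\<in>Pow (players N). \<Sum>T\<in>F \<inter> Pow S. c T)"

lemma dividend_game_in_games: "{} \<notin> F \<Longrightarrow> dividend_game N F c \<in> games N"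
  by (auto simp: games_def dividend_game_def)

lemma dividend_game_insert:
  assumes "finite F" "T \<notin> F"
  shows "dividend_game N (insert T F) c = game_add N (dividend_game N {T} c) (dividend_game N F c)"
  using assms by (auto simp: dividend_game_def game_add_def Int_insert_left fun_eq_iff)

text \<open>The signed subset-sum transform that defines \<open>g\<close> is an involution, so
  applying it again recovers \<open>v\<close>; the dividend of \<open>T\<close> is therefore
  \<open>(-1) ^ card T * g T\<close>.\<close>

lemma game_eq_dividend_game:
  assumes "v \<in> games N"
  obtains c where "v = dividend_game N (Pow (players N) - {{}}) c"
proof
  define g where "g S = (\<Sum>T\<in>Pow S. (-1) ^ card T * v T)" for S
  show "v = dividend_game N (Pow (players N) - {{}}) (\<lambda>T. (-1) ^ card T * g T)"
  proof
    fix S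
    show "v S = dividend_game N (Pow (players N) - {{}}) (\<lambda>T. (-1) ^ card T * g T) S"
    proof (cases "S \<subseteq> players N")
      case True
      then have fin: "finite S" by (auto intro: finite_subset)
      have "v S = (\<Sum>T\<in>Pow S. (-1) ^ card T * g T)"
        using fin by (rule inclusion_exclusion_symmetric[rotated]) (simp add: g_def)
      \<comment> \<open>The empty coalition may be dropped because
        \<open>g {} = v {} = 0\<close>.\<close>
      also have "\<dots> = (\<Sum>T\<in>(Pow (players N) - {{}}) \<inter> Pow S. (-1) ^ card T * g T)"
        using fin True assms by (intro sum.mono_neutral_right) (auto simp: g_def games_def)
      finally show ?thesis using True by (simp add: dividend_game_def)
    next
      case False
      then show ?thesis using assms by (auto simp: dividend_game_def games_def)
    qed
  qed
qed

lemma shapley_axioms_unanimity: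
  assumes ax: "shapley_axioms N \<psi>"
    and T: "T \<subseteq> players N" "T \<noteq> {}"
    and i: "i \<in> players N"
  shows "\<psi> (dividend_game N {T} c) i = (if i \<in> T then c T / real (card T) else 0)"
proof -
  let ?u = "dividend_game N {T} c"
  have u: "?u S = (if T \<subseteq> S then c T else 0)" if "S \<subseteq> players N" for S
    using that by (simp add: dividend_game_def Int_insert_left)
  have game: "?u \<in> games N" using T by (intro dividend_game_in_games) auto
  have null: "\<psi> ?u j = 0" if "j \<in> players N" "j \<notin> T" for j
  proof -
    have "\<forall>S. S \<subseteq> players N \<longrightarrow> ?u (S \<union> {j}) = ?u S"
      using that by (auto simp: u)
    then show ?thesis
      using ax game that unfolding shapley_axioms_def null_player_def by blast
  qed
  have sym: "\<psi> ?u j = \<psi> ?u i" if "i \<in> T" "j \<in> T" for j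
  proof -
    \<comment> \<open>For distinct \<open>i\<close> and \<open>j\<close> in \<open>T\<close>, each
      side fails, since each enlarged set misses one of the two.\<close>
    have "T \<subseteq> S \<union> {j} \<longleftrightarrow> T \<subseteq> S \<union> {i}" if "j \<notin> S" "i \<notin> S" for S
      using that \<open>i \<in> T\<close> \<open>j \<in> T\<close> by auto
    moreover have "j \<in> players N" using \<open>j \<in> T\<close> T by auto
    ultimately have
      "\<forall>S. S \<subseteq> players N \<and> j \<notin> S \<and> i \<notin> S \<longrightarrow> ?u (S \<union> {j}) = ?u (S \<union> {i})"
      using i by (simp add: u)
    then show ?thesis
      using ax game that T unfolding shapley_axioms_def symmetry_def by blast
  qed
  show ?thesis
  proof (cases "i \<in> T")
    case True
    have fin: "finite T" using T by (auto intro: finite_subset)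
    have "c T = ?u (players N)" using T by (simp add: u)
    also have "\<dots> = (\<Sum>j\<in>players N. \<psi> ?u j)"
      using ax game unfolding shapley_axioms_def efficiency_def by simp
    also have "\<dots> = (\<Sum>j\<in>T. \<psi> ?u j)"
      using T null by (intro sum.mono_neutral_right) auto
    also have "\<dots> = real (card T) * \<psi> ?u i"
      using sym[OF True] by simp
    finally show ?thesis
      using True fin T by (simp add: field_simps)
  qed (use i null in simp)
qed

lemma shapley_axioms_unique:
  assumes \<psi>: "shapley_axioms N \<psi>" and \<phi>: "shapley_axioms N \<phi>"
    and v: "v \<in> games N" and i: "i \<in> players N"
  shows "\<psi> v i = \<phi> v i"
proof -
  obtain c where c: "v = dividend_game N (Pow (players N) - {{}}) c"
    using game_eq_dividend_game[OF v] .
  have "\<psi> (dividend_game N F c) i = \<phi> (dividend_game N F c) i"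
    if "F \<subseteq> Pow (players N) - {{}}" for F
  proof -
    have "finite F" using that by (rule finite_subset) simp
    then show ?thesis using that
    proof induction
      case empty
      \<comment> \<open>The empty family gives the zero game, in which every player is null.\<close>
      have "\<forall>S. S \<subseteq> players N \<longrightarrow> dividend_game N {} c (S \<union> {i}) = dividend_game N {} c S"
        using i by (simp add: dividend_game_def)
      moreover have "dividend_game N {} c \<in> games N"
        by (simp add: dividend_game_in_games)
      ultimately have zero: "\<chi> (dividend_game N {} c) i = 0" if "shapley_axioms N \<chi>" for \<chi>
        using that i unfolding shapley_axioms_def null_player_def by blast
      show ?case by (simp only: zero[OF \<psi>] zero[OF \<phi>])
    next
      case (insert T F)
      have games: "dividend_game N {T} c \<in> games N" "dividend_game N F c \<in> games N"
        using insert.prems by (auto intro!: dividend_game_in_games)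
      have add: "\<chi> (dividend_game N (insert T F) c) i =
          \<chi> (dividend_game N {T} c) i + \<chi> (dividend_game N F c) i"
        if "shapley_axioms N \<chi>" for \<chi>
        using that games i unfolding dividend_game_insert[OF insert.hyps]
        by (simp add: shapley_axioms_def linearity_def)
      have "T \<subseteq> players N" "T \<noteq> {}" using insert.prems by auto
      then show ?case
        using insert i
        by (simp add: add[OF \<psi>] add[OF \<phi>] shapley_axioms_unanimity[OF \<psi>]
            shapley_axioms_unanimity[OF \<phi>])
    qed
  qed
  then show ?thesis by (simp add: c)
qed

theorem corollary5p1:
  fixes N K :: nat
    and b d :: "nat \<Rightarrow> real"
    and M :: "real set"
    and f :: "(nat \<times> real \<Rightarrow> real) \<Rightarrow> real"
  assumes "persistence_diagram N b d"
    and "K \<ge> 1"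
    and "finite M"
    and "model_game N K M b d f {} = 0"
  shows "shapley_axioms N (shapley N) \<and>
    (\<forall>\<psi>. shapley_axioms N \<psi> \<longrightarrow>
       (\<forall>i\<in>players N. \<psi> (model_game N K M b d f) i = shapley N (model_game N K M b d f) i))"
proof (intro conjI allI impI ballI)
  \<comment> \<open>The restriction to coalitions makes the model game extensional, and its value at
    the empty coalition is zero by assumption, so general uniqueness applies.\<close>
  have "model_game N K M b d f \<in> games N"
    using assms(4) by (simp add: games_def model_game_def)
  then show "\<psi> (model_game N K M b d f) i = shapley N (model_game N K M b d f) i"
    if "shapley_axioms N \<psi>" "i \<in> players N" for \<psi> i
    using that by (blast intro: shapley_axioms_unique shapley_axioms_shapley)
qed (rule shapley_axioms_shapley)

end
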